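(* Let $S$ be a nonempty (possibly infinite) set of positive integers, and let $n\ge 0$ and $k\ge 1$ be integers. Then $$ A_{n+1,S} = \sum_{\substack{s\in S\\ s\le n+1}} \frac{n!}{(n-s+1)!} A_{n-s+1,S},$$ $$ B_{n+1,S} = \sum_{\substack{s\in S\\ s\le n+1}} \binom{n}{s-1}B_{n-s+1,S},$$ $$ \begin{bmatrix}n+1 \\k \end{bmatrix}_S = \sum_{\substack{s\in S\\ s\le n+1}}\frac{n!}{(n-s+1)!}\begin{bmatrix}n-s+1 \\k-1 \end{bmatrix}_S,$$ $$ \begin{Bmatrix}n+1 \\k \end{Bmatrix}_S = \sum_{\substack{s\in S\\ s\le n+1}}\binom{n}{s-1}\begin{Bmatrix}n-s+1 \\k-1 \end{Bmatrix}_S.$$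
   Context: For a set $S$ of positive integers and integers $n,k\ge 0$: - $\begin{bmatrix}n\\k\end{bmatrix}_S$ is the number of permutations of $n$ labeled elements having exactly $k$ cycles, each cycle having a length (fixed points being cycles of length 1) belonging to $S$. - $\begin{Bmatrix}n\\k\end{Bmatrix}_S$ is the number of set partitions of an $n$-element set into exactly $k$ (nonempty, unlabeled) blocks, each block having size belonging to $S$. - $A_{n,S}$ is the number of permutations of $n$ labeled elements all of whose cycle lengths belong to $S$; $B_{n,S}$ is the number of set partitions of an $n$-element set all of whose block sizes belong to $S$. Initial values: $\begin{bmatrix}0\\0\end{bmatrix}_S=\begin{Bmatrix}0\\0\end{Bmatrix}_S=A_{0,S}=B_{0,S}=1$; for $n\ge1$, $k\ge1$, $\begin{bmatrix}n\\0\end{bmatrix}_S=\begin{Bmatrix}n\\0\end{Bmatrix}_S=\begin{bmatrix}0\\k\end{bmatrix}_S=\begin{Bmatrix}0\\k\end{Bmatrix}_S=0$. *)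

theory Defs
  imports
    Complex_Main
    "HOL-Combinatorics.Permutations"
    "HOL-Combinatorics.Orbits"
    "HOL-Library.Disjoint_Sets"
begin

text \<open>
  The orbit of a point under a permutation of a finite set is the support of the cycle
  through that point (a singleton for a fixed point). Hence the cycles of \<open>p\<close> on \<open>A\<close>
  correspond bijectively to the orbits, and cycle lengths are cardinalities of orbits.
\<close>
definition perm_cycles :: "('a \<Rightarrow> 'a) \<Rightarrow> 'a set \<Rightarrow> 'a set set" where
  "perm_cycles p A = orbit p ` A"

definition S_perms :: "nat set \<Rightarrow> 'a set \<Rightarrow> ('a \<Rightarrow> 'a) set" where
  "S_perms S A = {p. p permutes A \<and> (\<forall>C\<in>perm_cycles p A. card C \<in> S)}"

definition S_partitions :: "nat set \<Rightarrow> 'a set \<Rightarrow> 'a set set set" where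
  "S_partitions S A = {P. partition_on A P \<and> (\<forall>X\<in>P. card X \<in> S)}"

definition S_stirling1 :: "nat set \<Rightarrow> nat \<Rightarrow> nat \<Rightarrow> nat" where
  "S_stirling1 S n k = card {p \<in> S_perms S {..<n}. card (perm_cycles p {..<n}) = k}"

definition S_stirling2 :: "nat set \<Rightarrow> nat \<Rightarrow> nat \<Rightarrow> nat" where
  "S_stirling2 S n k = card {P \<in> S_partitions S {..<n}. card P = k}"

definition S_perm_count :: "nat set \<Rightarrow> nat \<Rightarrow> nat" where
  "S_perm_count S n = card (S_perms S {..<n})"

definition S_partition_count :: "nat set \<Rightarrow> nat \<Rightarrow> nat" where
  "S_partition_count S n = card (S_partitions S {..<n})"

lemma S_perms_empty: "S_perms S {} = {id}"
  by (auto simp: S_perms_def perm_cycles_def)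

lemma S_partitions_empty: "S_partitions S {} = {{}}"
  by (auto simp: S_partitions_def partition_on_def)

lemma S_counts_0:
  "S_perm_count S 0 = 1" "S_partition_count S 0 = 1"
  by (simp_all add: S_perm_count_def S_partition_count_def S_perms_empty S_partitions_empty)

lemma S_stirling1_0_left: "S_stirling1 S 0 k = (if k = 0 then 1 else 0)"
proof -
  have "{p \<in> S_perms S {..<0::nat}. card (perm_cycles p {..<0}) = k} = (if k = 0 then {id} else {})"
    by (auto simp: S_perms_empty perm_cycles_def)
  then show ?thesis by (simp add: S_stirling1_def)
qed

lemma S_stirling2_0_left: "S_stirling2 S 0 k = (if k = 0 then 1 else 0)"
proof -
  have "{P \<in> S_partitions S {..<0::nat}. card P = k} = (if k = 0 then {{}} else {})"
    by (auto simp: S_partitions_empty)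
  then show ?thesis by (simp add: S_stirling2_def)
qed

lemma S_stirling1_0_right: "n \<ge> 1 \<Longrightarrow> S_stirling1 S n 0 = 0"
  by (auto simp: S_stirling1_def perm_cycles_def lessThan_empty_iff)

lemma S_stirling2_0_right:
  assumes "n \<ge> 1"
  shows "S_stirling2 S n 0 = 0"
proof -
  have "card P \<noteq> 0" if "P \<in> S_partitions S {..<n}" for P
  proof -
    have P: "partition_on {..<n} P" using that by (simp add: S_partitions_def)
    have "finite P" using finite_elements[OF _ P] by simp
    moreover have "P \<noteq> {}"
    proof
      assume "P = {}"
      then have "{..<n} = {}" using partition_onD1[OF P] by simp
      then show False using assms by (simp add: lessThan_empty_iff)
    qed
    ultimately show ?thesis by simp
  qed
  then have "{P \<in> S_partitions S {..<n}. card P = 0} = {}" by blast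
  then show ?thesis unfolding S_stirling2_def by (metis card.empty)
qed

end

theory Submission
  imports Defs "HOL-Combinatorics.Cycles" "HOL-Combinatorics.Multiset_Permutations"
begin

text \<open>
  Fix an element \<open>a\<close> of the ground set and classify the structures by the block (cycle)
  containing \<open>a\<close>, that is, by the set \<open>C\<close> of the companions of \<open>a\<close>. Deleting this block leaves an
  arbitrary structure on the remaining elements with one block less. A block of size \<open>s\<close> can be
  chosen in \<open>n choose (s - 1)\<close> ways, and for permutations it carries \<open>(s - 1)!\<close> cycles. A predicate
  \<open>Q\<close> on the number of blocks treats the counts with and without prescribed \<open>k\<close> simultaneously.
\<close>

section \<open>Summation over the companions of a marked element\<close>

text \<open>The weight sees only the size of \<open>C\<close>, so the subsets are grouped by
  \<open>s = Suc (card C)\<close>; the group of \<open>s\<close> has \<open>n choose (s - 1)\<close>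
  members.\<close>

lemma sum_subsets_by_card:
  fixes w :: "nat \<Rightarrow> nat"
  assumes "finite A" "card A = n" "\<forall>s\<in>S. s \<ge> 1"
  shows "(\<Sum>C | C \<subseteq> A \<and> Suc (card C) \<in> S. w (card C)) =
    (\<Sum>s\<in>{s\<in>S. s \<le> n + 1}. (n choose (s - 1)) * w (s - 1))"
proof -
  let ?P = "{C. C \<subseteq> A \<and> Suc (card C) \<in> S}" and ?T = "{s\<in>S. s \<le> n + 1}"
  have fin: "finite ?P" using assms(1) by simp
  have sub: "(\<lambda>C. Suc (card C)) ` ?P \<subseteq> ?T"
    using card_mono[OF assms(1)] assms(2) by auto
  have "(\<Sum>C\<in>?P. w (card C)) = (\<Sum>s\<in>?T. \<Sum>C | C \<in> ?P \<and> Suc (card C) = s. w (card C))"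
    by (rule sum.group[symmetric, OF fin _ sub]) simp
  also have "\<dots> = (\<Sum>s\<in>?T. (n choose (s - 1)) * w (s - 1))"
  proof (rule sum.cong[OF refl])
    fix s assume s: "s \<in> ?T"
    \<comment> \<open>Positivity matters here: for \<open>s = 0\<close> the truncated
      \<open>s - 1\<close> would select the empty set, whose successor size is 1.\<close>
    then have "{C \<in> ?P. Suc (card C) = s} = {C. C \<subseteq> A \<and> card C = s - 1}"
      using assms(3) by force
    then show "(\<Sum>C | C \<in> ?P \<and> Suc (card C) = s. w (card C)) = (n choose (s - 1)) * w (s - 1)"
      using n_subsets[OF assms(1), of "s - 1"] assms(2) by simp
  qed
  finally show ?thesis .
qed

text \<open>Here \<open>F Q A\<close> stands for the number of structures on \<open>A\<close> whose
  number of blocks satisfies \<open>Q\<close>, and \<open>w c\<close> for the number of ways to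
  structure a block with \<open>c\<close> companions of \<open>a\<close>; the shift to
  \<open>Q (Suc m)\<close> pays for the deleted block. To collect terms by size, \<open>F\<close>
  must depend only on the cardinality of \<open>A\<close>. This is deduced from \<open>rec\<close>
  itself by induction, so no relabelling bijections are required.\<close>

lemma marked_block_recurrence:
  fixes F :: "(nat \<Rightarrow> bool) \<Rightarrow> nat set \<Rightarrow> nat"
  assumes rec: "\<And>Q A a. finite A \<Longrightarrow> a \<in> A \<Longrightarrow>
      F Q A = (\<Sum>C | C \<subseteq> A - {a} \<and> Suc (card C) \<in> S.
        w (card C) * F (\<lambda>m. Q (Suc m)) (A - insert a C))"
    and pos: "\<forall>s\<in>S. s \<ge> 1"
  shows "F Q {..<n + 1} =
    (\<Sum>s\<in>{s\<in>S. s \<le> n + 1}. (n choose (s - 1)) * (w (s - 1) * F (\<lambda>m. Q (Suc m)) {..<n + 1 - s}))"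
proof -
  \<comment> \<open>Invariance is assumed only on proper subsets of \<open>A\<close>, so this serves
    both inside the induction proving \<open>inv\<close> and, once \<open>inv\<close> is known, for
    the final claim.\<close>
  have *: "F Q A = (\<Sum>s\<in>{s\<in>S. s \<le> n + 1}.
      (n choose (s - 1)) * (w (s - 1) * F (\<lambda>m. Q (Suc m)) {..<n + 1 - s}))"
    if A: "finite A" "card A = Suc n"
      and IH: "\<And>B Q. B \<subset> A \<Longrightarrow> F Q B = F Q {..<card B}" for A Q n
  proof -
    obtain a where a: "a \<in> A" using A(2) by fastforce
    have "F Q A = (\<Sum>C | C \<subseteq> A - {a} \<and> Suc (card C) \<in> S.
        w (card C) * F (\<lambda>m. Q (Suc m)) {..<n - card C})"
      unfolding rec[OF A(1) a]
    proof (rule sum.cong[OF refl])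
      fix C assume "C \<in> {C. C \<subseteq> A - {a} \<and> Suc (card C) \<in> S}"
      then have C: "insert a C \<subseteq> A" "a \<notin> C" using a by auto
      have fin: "finite (insert a C)" using C(1) A(1) by (rule finite_subset)
      then have "card (insert a C) = Suc (card C)" using C(2) by simp
      then have "card (A - insert a C) = n - card C"
        using card_Diff_subset[OF fin C(1)] A(2) by simp
      moreover have "A - insert a C \<subset> A" using a by blast
      ultimately show "w (card C) * F (\<lambda>m. Q (Suc m)) (A - insert a C) =
          w (card C) * F (\<lambda>m. Q (Suc m)) {..<n - card C}"
        by (simp add: IH)
    qed
    also have "\<dots> = (\<Sum>s\<in>{s\<in>S. s \<le> n + 1}.
        (n choose (s - 1)) * (w (s - 1) * F (\<lambda>m. Q (Suc m)) {..<n - (s - 1)}))"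
      using A a by (intro sum_subsets_by_card pos) auto
    also have "\<dots> = (\<Sum>s\<in>{s\<in>S. s \<le> n + 1}.
        (n choose (s - 1)) * (w (s - 1) * F (\<lambda>m. Q (Suc m)) {..<n + 1 - s}))"
    proof (rule sum.cong[OF refl])
      fix s assume "s \<in> {s\<in>S. s \<le> n + 1}"
      then have "n - (s - 1) = n + 1 - s" using pos by auto
      then show "(n choose (s - 1)) * (w (s - 1) * F (\<lambda>m. Q (Suc m)) {..<n - (s - 1)}) =
          (n choose (s - 1)) * (w (s - 1) * F (\<lambda>m. Q (Suc m)) {..<n + 1 - s})"
        by simp
    qed
    finally show ?thesis .
  qed
  have inv: "F Q A = F Q {..<card A}" if "finite A" for A Q
    using that
  proof (induction "card A" arbitrary: A Q rule: less_induct)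
    case less
    show ?case
    proof (cases "card A")
      case 0
      then show ?thesis using less.prems by simp
    next
      case (Suc n)
      \<comment> \<open>Stated for every \<open>A'\<close> of the size of \<open>A\<close>, because
        it is applied to \<open>A\<close> and to the initial segment
        \<open>{..<Suc n}\<close>.\<close>
      have IH: "F Q B = F Q {..<card B}" if "B \<subset> A'" "finite A'" "card A' = card A" for B Q A'
        using less.hyps[of B] that by (metis finite_subset psubset_card_mono psubset_imp_subset)
      \<comment> \<open>The right-hand side of \<open>*\<close> mentions the ground set only through
        \<open>n\<close>, hence both sets give the same value.\<close>
      have "F Q A = F Q {..<Suc n}"
        using *[OF less.prems Suc IH[OF _ less.prems refl]]
          *[of "{..<Suc n}" n, OF _ _ IH[of _ "{..<Suc n}"]] Suc by simp
      then show ?thesis using Suc by simp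
    qed
  qed
  show ?thesis
    by (rule *) (auto intro: inv finite_subset)
qed

subsection \<open>Permutations\<close>

text \<open>Applying the cycle \<open>i\<close> times to all entries rotates the list by
  \<open>i\<close>, and the head of the rotated list is the \<open>i\<close>-th entry.\<close>

lemma funpow_cycle_of_list_hd:
  assumes "distinct cs" "i < length cs"
  shows "(cycle_of_list cs ^^ i) (hd cs) = cs ! i"
proof -
  have "cs \<noteq> []" using assms(2) by auto
  then have "(cycle_of_list cs ^^ i) (hd cs) = hd (rotate i cs)"
    using cyclic_rotation[OF assms(1), of i] by (metis list.map_sel(1))
  then show ?thesis using \<open>cs \<noteq> []\<close> assms(2) by (simp add: hd_rotate_conv_nth)
qed

lemma cyclic_on_cycle_of_list:
  assumes "distinct cs" "cs \<noteq> []"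
  shows "cyclic_on (cycle_of_list cs) (set cs)"
proof (rule cyclic_on_singleI)
  show "hd cs \<in> set cs" using assms by simp
  show "set cs = orbit (cycle_of_list cs) (hd cs)"
  proof
    show "orbit (cycle_of_list cs) (hd cs) \<subseteq> set cs"
      using assms by (intro permutes_orbit_subset cycle_permutes) simp
    show "set cs \<subseteq> orbit (cycle_of_list cs) (hd cs)"
    proof
      fix x assume "x \<in> set cs"
      then obtain i where "i < length cs" "x = cs ! i" by (auto simp: in_set_conv_nth)
      then have "x = (cycle_of_list cs ^^ i) (hd cs)"
        using funpow_cycle_of_list_hd[OF assms(1)] by simp
      then show "x \<in> orbit (cycle_of_list cs) (hd cs)"
        unfolding orbit_altdef_permutation[OF permutation_of_cycle] by blast
    qed
  qed
qed

text \<open>A cycle on \<open>B\<close> has exactly one list notation starting with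
  \<open>a\<close>: its iterates at \<open>a\<close> recover the list. The tail is an arbitrary
  arrangement of \<open>B - {a}\<close>, which gives the factorial.\<close>

lemma card_cyclic_perms:
  assumes "finite B" "a \<in> B"
  shows "card {c. c permutes B \<and> cyclic_on c B} = fact (card B - 1)"
proof -
  have "bij_betw (\<lambda>xs. cycle_of_list (a # xs)) (permutations_of_set (B - {a}))
      {c. c permutes B \<and> cyclic_on c B}"
  proof (rule bij_betw_imageI)
    show "inj_on (\<lambda>xs. cycle_of_list (a # xs)) (permutations_of_set (B - {a}))"
    proof (rule inj_onI)
      fix xs ys
      assume xs: "xs \<in> permutations_of_set (B - {a})" and ys: "ys \<in> permutations_of_set (B - {a})"
        and eq: "cycle_of_list (a # xs) = cycle_of_list (a # ys)"
      from xs ys have d: "distinct (a # xs)" "distinct (a # ys)"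
        by (auto dest: permutations_of_setD)
      have len: "length xs = length ys"
        using xs ys by (metis distinct_card permutations_of_setD)
      have "a # xs = a # ys"
      proof (rule nth_equalityI)
        fix i assume i: "i < length (a # xs)"
        show "(a # xs) ! i = (a # ys) ! i"
          using funpow_cycle_of_list_hd[OF d(1) i] funpow_cycle_of_list_hd[OF d(2), of i] i len eq
          by simp
      qed (simp add: len)
      then show "xs = ys" by simp
    qed
    show "(\<lambda>xs. cycle_of_list (a # xs)) ` permutations_of_set (B - {a}) =
        {c. c permutes B \<and> cyclic_on c B}"
    proof (intro equalityI subsetI)
      fix c assume "c \<in> (\<lambda>xs. cycle_of_list (a # xs)) ` permutations_of_set (B - {a})"
      then obtain xs where xs: "c = cycle_of_list (a # xs)" "set xs = B - {a}" "distinct xs"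
        by (auto dest: permutations_of_setD)
      then have "set (a # xs) = B" using assms(2) by auto
      then show "c \<in> {c. c permutes B \<and> cyclic_on c B}"
        using cyclic_on_cycle_of_list[of "a # xs"] cycle_permutes[of "a # xs"] xs by simp
    next
      fix c assume "c \<in> {c. c permutes B \<and> cyclic_on c B}"
      then have c: "c permutes B" "cyclic_on c B" by auto
      then have perm: "permutation c" using assms(1) by (auto simp: permutation_permutes)
      \<comment> \<open>\<open>support c a\<close> lists the iterates of \<open>c\<close> from
        \<open>a\<close> until the first return, so it is the list notation sought.\<close>
      have set: "set (support c a) = B"
        unfolding support_set[OF perm]
        using orbit_cyclic_eq3[OF c(2) assms(2)] orbit_altdef_permutation[OF perm, of a] by auto
      obtain xs where xs: "support c a = a # xs"
        using least_power_of_permutation(2)[OF perm, of a] by (simp add: upt_conv_Cons)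
      have d: "distinct (a # xs)" using cycle_of_permutation[OF perm, of a] xs by simp
      then have "xs \<in> permutations_of_set (B - {a})"
        using set xs by (intro permutations_of_setI) auto
      moreover have "c = cycle_of_list (a # xs)"
      proof
        fix x show "c x = cycle_of_list (a # xs) x"
        proof (cases "x \<in> B")
          case True
          then show ?thesis using cycle_restrict[OF perm, of x a] unfolding set unfolding xs by blast
        next
          case False
          then show ?thesis
            using id_outside_supp[of x "a # xs"] permutes_not_in[OF c(1), of x] False set
            unfolding xs by metis
        qed
      qed
      ultimately show "c \<in> (\<lambda>xs. cycle_of_list (a # xs)) ` permutations_of_set (B - {a})" by blast
    qed
  qed
  then have "card {c. c permutes B \<and> cyclic_on c B} = card (permutations_of_set (B - {a}))"
    by (rule bij_betw_same_card[symmetric])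
  then show ?thesis using assms by simp
qed

section \<open>Splitting off one cycle of a permutation\<close>

lemma perm_cycles_split:
  assumes "cyclic_on p B" "B \<subseteq> A" "\<And>x. x \<in> A - B \<Longrightarrow> p x = q x" "q permutes A - B"
  shows "perm_cycles p A = insert B (perm_cycles q (A - B))"
proof -
  have "B \<noteq> {}" using assms(1) by (auto simp: cyclic_on_def)
  have "orbit p x = B" if "x \<in> B" for x
    using assms(1) that by (rule orbit_cyclic_eq3)
  then have "orbit p ` B = {B}" using \<open>B \<noteq> {}\<close> by auto
  moreover have "orbit p x = orbit q x" if "x \<in> A - B" for x
    using that assms(3) permutes_in_image[OF assms(4)] by (intro orbit_cong0[of x "A - B"]) auto
  then have "orbit p ` (A - B) = orbit q ` (A - B)" by (rule image_cong[OF refl])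
  moreover have "A = B \<union> (A - B)" using assms(2) by blast
  ultimately show ?thesis
    unfolding perm_cycles_def by (metis image_Un insert_is_Un)
qed

text \<open>A permutation having \<open>B\<close> as a cycle factors uniquely into a cycle on
  \<open>B\<close> and a permutation of the rest; the factors are its restrictions to
  \<open>B\<close> and \<open>A - B\<close>.\<close>

lemma bij_betw_comp_cyclic:
  assumes "B \<subseteq> A"
  shows "bij_betw (\<lambda>(c, q). c \<circ> q) ({c. c permutes B \<and> cyclic_on c B} \<times> {q. q permutes A - B})
    {p. p permutes A \<and> cyclic_on p B}"
proof (rule bij_betw_byWitness[where f' = "\<lambda>p. (perm_restrict p B, perm_restrict p (A - B))"])
  have *: "(c \<circ> q) x = (if x \<in> B then c x else q x)" if "c permutes B" "q permutes A - B" for c q x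
    using that permutes_in_image[OF that(2), of x] permutes_not_in[OF that(1)]
      permutes_not_in[OF that(2)] by (cases "x \<in> A") auto
  show "\<forall>z\<in>{c. c permutes B \<and> cyclic_on c B} \<times> {q. q permutes A - B}.
      (perm_restrict ((\<lambda>(c, q). c \<circ> q) z) B, perm_restrict ((\<lambda>(c, q). c \<circ> q) z) (A - B)) = z"
    by (auto simp: perm_restrict_def fun_eq_iff * permutes_not_in simp del: o_apply)
  show "\<forall>p\<in>{p. p permutes A \<and> cyclic_on p B}.
      (\<lambda>(c, q). c \<circ> q) (perm_restrict p B, perm_restrict p (A - B)) = p"
  proof
    fix p assume "p \<in> {p. p permutes A \<and> cyclic_on p B}"
    then have p: "p permutes A" "cyclic_on p B" by auto
    \<comment> \<open>Needed because the restriction to \<open>B\<close> is applied second: it must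
      leave the images of points outside \<open>B\<close> alone.\<close>
    have "p x \<notin> B" if "x \<notin> B" for x
      using cyclic_on_f_in[OF p] that by blast
    then show "(\<lambda>(c, q). c \<circ> q) (perm_restrict p B, perm_restrict p (A - B)) = p"
      using permutes_not_in[OF p(1)] assms by (auto simp: perm_restrict_def fun_eq_iff)
  qed
  show "(\<lambda>(c, q). c \<circ> q) ` ({c. c permutes B \<and> cyclic_on c B} \<times> {q. q permutes A - B})
      \<subseteq> {p. p permutes A \<and> cyclic_on p B}"
  proof clarsimp
    fix c q assume cq: "c permutes B" "cyclic_on c B" "q permutes A - B"
    have "c \<circ> q permutes A"
      using cq assms by (intro permutes_compose) (auto intro: permutes_subset)
    moreover have "cyclic_on (c \<circ> q) B"
      using cq by (intro permutes_comp_preserves_cyclic1[of q "A - B" c B B]) auto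
    ultimately show "c \<circ> q permutes A \<and> cyclic_on (c \<circ> q) B" by simp
  qed
  show "(\<lambda>p. (perm_restrict p B, perm_restrict p (A - B))) ` {p. p permutes A \<and> cyclic_on p B}
      \<subseteq> {c. c permutes B \<and> cyclic_on c B} \<times> {q. q permutes A - B}"
  proof clarsimp
    fix p assume p: "p permutes A" "cyclic_on p B"
    have "p ` B = B"
    proof
      show "p ` B \<subseteq> B" using cyclic_on_inI[OF p(2)] by blast
      have "x \<in> p ` B" if "x \<in> B" for x
        using that cyclic_on_f_in[OF p, of "inv p x"] permutes_inverses(1)[OF p(1), of x]
        by (metis imageI)
      then show "B \<subseteq> p ` B" by blast
    qed
    then have "perm_restrict p B permutes B"
      using permutes_inj[OF p(1)]
      by (intro bij_imp_permutes)
        (auto simp: bij_betw_def perm_restrict_def inj_on_def inj_def)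
    then show "perm_restrict p B permutes B \<and> cyclic_on (perm_restrict p B) B \<and>
        perm_restrict p (A - B) permutes A - B"
      using p perm_restrict_diff_cyclic[OF p] by (simp add: cyclic_on_perm_restrict)
  qed
qed

text \<open>The factor on \<open>B\<close> contributes just the one cycle \<open>B\<close>, of
  admissible length, so every remaining condition falls on \<open>q\<close>. The set counted is thus
  a product, with \<open>card_cyclic_perms\<close> counting the first factor.\<close>

lemma card_S_perms_with_cycle:
  assumes "finite A" "B \<subseteq> A" "a \<in> B" "card B \<in> S"
  shows "card {p \<in> S_perms S A. Q (card (perm_cycles p A)) \<and> orbit p a = B} =
    fact (card B - 1) * card {q \<in> S_perms S (A - B). Q (Suc (card (perm_cycles q (A - B))))}"
proof -
  let ?C = "{c. c permutes B \<and> cyclic_on c B}"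
  let ?X = "{q \<in> S_perms S (A - B). Q (Suc (card (perm_cycles q (A - B))))}"
  let ?Y = "{p \<in> S_perms S A. Q (card (perm_cycles p A)) \<and> orbit p a = B}"
  let ?f = "\<lambda>(c, q). c \<circ> q :: 'a \<Rightarrow> 'a"
  have finB: "finite B" using assms finite_subset by blast
  note bij = bij_betw_comp_cyclic[OF assms(2)]
  have iff: "c \<circ> q \<in> ?Y \<longleftrightarrow> q \<in> ?X" if c: "c permutes B" "cyclic_on c B" and q: "q permutes A - B" for c q
  proof -
    have "?f (c, q) \<in> {p. p permutes A \<and> cyclic_on p B}"
      using bij_betwE[OF bij] c q by blast
    then have p: "c \<circ> q permutes A" "cyclic_on (c \<circ> q) B" by auto
    have "(c \<circ> q) x = q x" if "x \<in> A - B" for x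
      using that permutes_in_image[OF q, of x] permutes_not_in[OF c(1)] by simp
    then have cyc: "perm_cycles (c \<circ> q) A = insert B (perm_cycles q (A - B))"
      using p(2) assms(2) q by (intro perm_cycles_split) auto
    have "X \<subseteq> A - B" if "X \<in> perm_cycles q (A - B)" for X
      using that permutes_orbit_subset[OF q] by (auto simp: perm_cycles_def)
    \<comment> \<open>Cycles of \<open>q\<close> avoid \<open>a\<close>, so inserting
      \<open>B\<close> really adds one cycle; this produces the \<open>Suc\<close> inside
      \<open>Q\<close>.\<close>
    then have "B \<notin> perm_cycles q (A - B)" using assms(3) by blast
    moreover have "finite (perm_cycles q (A - B))" using assms(1) by (simp add: perm_cycles_def)
    ultimately have "card (perm_cycles (c \<circ> q) A) = Suc (card (perm_cycles q (A - B)))"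
      by (simp add: cyc)
    then show ?thesis
      using p q assms(4) orbit_cyclic_eq3[OF p(2) assms(3)] by (simp add: S_perms_def cyc)
  qed
  have "bij_betw ?f (?C \<times> ?X) ?Y"
  proof (rule bij_betw_subset[OF bij])
    show "?C \<times> ?X \<subseteq> ?C \<times> {q. q permutes A - B}" by (auto simp: S_perms_def)
    show "?f ` (?C \<times> ?X) = ?Y"
    proof
      show "?f ` (?C \<times> ?X) \<subseteq> ?Y"
      proof
        fix p assume "p \<in> ?f ` (?C \<times> ?X)"
        then obtain c q where "p = c \<circ> q" "c \<in> ?C" "q \<in> ?X" by force
        moreover from this have "q permutes A - B" by (simp add: S_perms_def)
        ultimately show "p \<in> ?Y" using iff[of c q] by blast
      qed
      show "?Y \<subseteq> ?f ` (?C \<times> ?X)"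
      proof
        fix p assume p: "p \<in> ?Y"
        then have "p permutes A" by (simp add: S_perms_def)
        moreover have "cyclic_on p B"
          using cyclic_on_orbit[OF \<open>p permutes A\<close> assms(1), of a] p by simp
        ultimately obtain c q where "p = c \<circ> q" "c \<in> ?C" "q permutes A - B"
          using bij_betw_imp_surj_on[OF bij] by force
        moreover from this have "q \<in> ?X" using iff[of c q] p by blast
        ultimately show "p \<in> ?f ` (?C \<times> ?X)" by force
      qed
    qed
  qed
  then have "card ?Y = card (?C \<times> ?X)" by (rule bij_betw_same_card[symmetric])
  then show ?thesis by (simp add: card_cartesian_product card_cyclic_perms[OF finB assms(3)])
qed

text \<open>The permutations are split into fibres by the orbit of \<open>a\<close> with
  \<open>a\<close> removed. Since \<open>card (insert a C) - 1 = card C\<close>, the number of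
  cycles on the marked support is \<open>fact (card C)\<close>.\<close>

lemma card_S_perms_marked:
  assumes "finite A" "a \<in> A"
  shows "card {p \<in> S_perms S A. Q (card (perm_cycles p A))} =
    (\<Sum>C | C \<subseteq> A - {a} \<and> Suc (card C) \<in> S. fact (card C) *
      card {q \<in> S_perms S (A - insert a C). Q (Suc (card (perm_cycles q (A - insert a C))))})"
proof -
  let ?P = "{C. C \<subseteq> A - {a} \<and> Suc (card C) \<in> S}"
  let ?X = "{p \<in> S_perms S A. Q (card (perm_cycles p A))}"
  have finX: "finite ?X"
    using finite_permutations[OF assms(1)] by (rule rev_finite_subset) (auto simp: S_perms_def)
  have finP: "finite ?P" using assms(1) by simp
  have sub: "(\<lambda>p. orbit p a - {a}) ` ?X \<subseteq> ?P"
  proof clarsimp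
    fix p assume "p \<in> S_perms S A"
    then have p: "p permutes A" "card (orbit p a) \<in> S"
      using assms(2) by (auto simp: S_perms_def perm_cycles_def)
    \<comment> \<open>An \<open>orbit\<close> starts at \<open>p a\<close>, not at \<open>a\<close>;
      finiteness of \<open>A\<close> ensures that the iterates return.\<close>
    have a: "a \<in> orbit p a"
      using p(1) assms(1) by (intro permutation_self_in_orbit) (auto simp: permutation_permutes)
    have "orbit p a \<subseteq> A" using p(1) assms(2) by (rule permutes_orbit_subset)
    moreover have "Suc (card (orbit p a - {a})) = card (orbit p a)"
      using card_Suc_Diff1[OF finite_orbit[OF a] a] .
    ultimately show "orbit p a - {a} \<subseteq> A - {a} \<and> Suc (card (orbit p a - {a})) \<in> S"
      using p(2) by auto
  qed
  have "card ?X = (\<Sum>C\<in>?P. card {p \<in> ?X. orbit p a - {a} = C})"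
    using sum.group[OF finX finP sub, of "\<lambda>_. 1::nat"] by simp
  also have "\<dots> = (\<Sum>C\<in>?P. fact (card C) *
      card {q \<in> S_perms S (A - insert a C). Q (Suc (card (perm_cycles q (A - insert a C))))})"
  proof (rule sum.cong[OF refl])
    fix C assume C: "C \<in> ?P"
    then have "finite C" using assms(1) finite_subset by blast
    then have card: "card (insert a C) = Suc (card C)" using C by (subst card_insert_disjoint) auto
    have "orbit p a - {a} = C \<longleftrightarrow> orbit p a = insert a C" if "p \<in> ?X" for p
    proof -
      have "a \<in> orbit p a"
        using that assms(1) by (intro permutation_self_in_orbit) (auto simp: S_perms_def permutation_permutes)
      then show ?thesis using C by auto
    qed
    then have "{p \<in> ?X. orbit p a - {a} = C} =
        {p \<in> S_perms S A. Q (card (perm_cycles p A)) \<and> orbit p a = insert a C}"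
      by blast
    then show "card {p \<in> ?X. orbit p a - {a} = C} = fact (card C) *
        card {q \<in> S_perms S (A - insert a C). Q (Suc (card (perm_cycles q (A - insert a C))))}"
      using card_S_perms_with_cycle[OF assms(1), of "insert a C" a S Q] C assms(2) card by auto
  qed
  finally show ?thesis .
qed

subsection \<open>Set partitions\<close>

text \<open>Removing and inserting the block \<open>B\<close> are mutually inverse. A partition of
  \<open>A - B\<close> cannot already contain the nonempty \<open>B\<close>, so the number of blocks
  changes by exactly one.\<close>

lemma card_S_partitions_with_block:
  assumes "finite A" "B \<subseteq> A" "B \<noteq> {}" "card B \<in> S"
  shows "card {P \<in> S_partitions S A. Q (card P) \<and> B \<in> P} =
    card {P \<in> S_partitions S (A - B). Q (Suc (card P))}"
proof -
  have notin: "B \<notin> P" "finite P" "disjnt B (\<Union>P)" if "P \<in> S_partitions S (A - B)" for P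
  proof -
    from that have P: "partition_on (A - B) P" by (simp add: S_partitions_def)
    show "finite P" using finite_elements[OF _ P] assms(1) by simp
    show "disjnt B (\<Union>P)" using partition_onD1[OF P] by (auto simp: disjnt_def)
    then show "B \<notin> P" using assms(3) by (auto simp: disjnt_def)
  qed
  have "bij_betw (insert B) {P \<in> S_partitions S (A - B). Q (Suc (card P))}
      {P \<in> S_partitions S A. Q (card P) \<and> B \<in> P}"
  proof (rule bij_betw_byWitness[where f' = "\<lambda>P. P - {B}"])
    show "insert B ` {P \<in> S_partitions S (A - B). Q (Suc (card P))}
        \<subseteq> {P \<in> S_partitions S A. Q (card P) \<and> B \<in> P}"
      using notin assms by (auto simp: S_partitions_def partition_on_insert)
    show "(\<lambda>P. P - {B}) ` {P \<in> S_partitions S A. Q (card P) \<and> B \<in> P}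
        \<subseteq> {P \<in> S_partitions S (A - B). Q (Suc (card P))}"
    proof (rule image_subsetI)
      fix P assume "P \<in> {P \<in> S_partitions S A. Q (card P) \<and> B \<in> P}"
      then have P: "P \<in> S_partitions S A" "Q (card P)" "B \<in> P" by auto
      then have part: "partition_on A P" by (simp add: S_partitions_def)
      have "disjnt B (\<Union>(P - {B}))"
        using partition_onD2[OF part] P(3) by (auto simp: disjoint_def disjnt_def)
      moreover have "insert B (P - {B}) = P" using P(3) by blast
      ultimately have "partition_on (A - B) (P - {B})"
        using partition_on_insert[of B "P - {B}" A] part by simp
      moreover have "Suc (card (P - {B})) = card P"
        using finite_elements[OF assms(1) part] P(3) by (rule card_Suc_Diff1)
      ultimately show "P - {B} \<in> {P \<in> S_partitions S (A - B). Q (Suc (card P))}"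
        using P by (simp add: S_partitions_def)
    qed
  qed (use notin in auto)
  then show ?thesis by (rule bij_betw_same_card[symmetric])
qed

text \<open>Every partition has exactly one block containing \<open>a\<close>, so the classes
  \<open>?Y C\<close> cover all partitions and are pairwise disjoint.\<close>

lemma card_S_partitions_marked:
  assumes "finite A" "a \<in> A"
  shows "card {P \<in> S_partitions S A. Q (card P)} =
    (\<Sum>C | C \<subseteq> A - {a} \<and> Suc (card C) \<in> S.
      card {P \<in> S_partitions S (A - insert a C). Q (Suc (card P))})"
proof -
  let ?I = "{C. C \<subseteq> A - {a} \<and> Suc (card C) \<in> S}"
  let ?Y = "\<lambda>C. {P \<in> S_partitions S A. Q (card P) \<and> insert a C \<in> P}"
  have fin: "finite (S_partitions S A)"
    using finitely_many_partition_on[OF assms(1)]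
    by (rule rev_finite_subset) (auto simp: S_partitions_def)
  have card: "card (insert a C) = Suc (card C)" if "C \<subseteq> A - {a}" for C
    using that assms(1) by (subst card_insert_disjoint) (auto intro: finite_subset)
  have "{P \<in> S_partitions S A. Q (card P)} = (\<Union>C\<in>?I. ?Y C)"
  proof
    show "{P \<in> S_partitions S A. Q (card P)} \<subseteq> (\<Union>C\<in>?I. ?Y C)"
    proof clarsimp
      fix P assume P: "P \<in> S_partitions S A" "Q (card P)"
      then have part: "partition_on A P" by (simp add: S_partitions_def)
      obtain B where B: "B \<in> P" "a \<in> B" using partition_onD1[OF part] assms(2) by auto
      have BA: "B \<subseteq> A" using partition_onD1[OF part] B by auto
      have eq: "insert a (B - {a}) = B" using B by blast
      have "B - {a} \<subseteq> A - {a}" using BA by blast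
      then have "Suc (card (B - {a})) = card B" using card[of "B - {a}"] eq by simp
      then have "Suc (card (B - {a})) \<in> S" using B(1) P(1) by (simp add: S_partitions_def)
      then show "\<exists>C. C \<subseteq> A - {a} \<and> Suc (card C) \<in> S \<and> insert a C \<in> P"
        using BA B eq by (intro exI[of _ "B - {a}"]) auto
    qed
  qed auto
  also have "card \<dots> = (\<Sum>C\<in>?I. card (?Y C))"
  proof (rule card_UN_disjoint)
    show "finite ?I" using assms(1) by simp
    show "\<forall>C\<in>?I. finite (?Y C)" using fin by simp
    show "\<forall>C\<in>?I. \<forall>D\<in>?I. C \<noteq> D \<longrightarrow> ?Y C \<inter> ?Y D = {}"
    proof (intro ballI impI equals0I)
      fix C D P assume CD: "C \<in> ?I" "D \<in> ?I" "C \<noteq> D" and P: "P \<in> ?Y C \<inter> ?Y D"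
      then have "disjoint P" "insert a C \<in> P" "insert a D \<in> P"
        by (auto simp: S_partitions_def partition_on_def)
      moreover have "\<not> disjnt (insert a C) (insert a D)" by simp
      \<comment> \<open>Two blocks sharing \<open>a\<close> coincide; as neither \<open>C\<close>
        nor \<open>D\<close> contains \<open>a\<close>, they coincide too.\<close>
      ultimately have "insert a C = insert a D" by (meson pairwiseD)
      then show False using CD by blast
    qed
  qed
  also have "\<dots> = (\<Sum>C\<in>?I. card {P \<in> S_partitions S (A - insert a C). Q (Suc (card P))})"
    using assms card by (intro sum.cong[OF refl] card_S_partitions_with_block) auto
  finally show ?thesis .
qed

subsection \<open>The recurrences\<close>

text \<open>The weight of a block is \<open>fact (s - 1)\<close>, which cancels against the
  denominator of the binomial coefficient; the passage to \<open>real\<close> makes the remaining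
  quotient an ordinary division.\<close>

lemma card_S_perms_recurrence:
  assumes "\<forall>s\<in>S. s \<ge> 1"
  shows "real (card {p \<in> S_perms S {..<n + 1}. Q (card (perm_cycles p {..<n + 1}))}) =
    (\<Sum>s\<in>{s\<in>S. s \<le> n + 1}. fact n / fact (n + 1 - s) *
      real (card {p \<in> S_perms S {..<n + 1 - s}. Q (Suc (card (perm_cycles p {..<n + 1 - s})))}))"
proof -
  define F where "F Q A = card {p \<in> S_perms S A. Q (card (perm_cycles p A))}"
    for Q and A :: "nat set"
  have "F Q {..<n + 1} = (\<Sum>s\<in>{s\<in>S. s \<le> n + 1}.
      (n choose (s - 1)) * (fact (s - 1) * F (\<lambda>m. Q (Suc m)) {..<n + 1 - s}))"
    by (rule marked_block_recurrence[OF _ assms]) (simp add: F_def card_S_perms_marked)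
  then have "real (F Q {..<n + 1}) = (\<Sum>s\<in>{s\<in>S. s \<le> n + 1}.
      real (n choose (s - 1)) * (fact (s - 1) * real (F (\<lambda>m. Q (Suc m)) {..<n + 1 - s})))"
    by simp
  also have "\<dots> = (\<Sum>s\<in>{s\<in>S. s \<le> n + 1}. fact n / fact (n + 1 - s) *
      real (F (\<lambda>m. Q (Suc m)) {..<n + 1 - s}))"
  proof (rule sum.cong[OF refl])
    fix s assume "s \<in> {s\<in>S. s \<le> n + 1}"
    then have "s - 1 \<le> n" "n - (s - 1) = n + 1 - s" using assms by auto
    then show "real (n choose (s - 1)) * (fact (s - 1) * real (F (\<lambda>m. Q (Suc m)) {..<n + 1 - s})) =
        fact n / fact (n + 1 - s) * real (F (\<lambda>m. Q (Suc m)) {..<n + 1 - s})"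
      by (simp add: binomial_fact)
  qed
  finally show ?thesis by (simp only: F_def)
qed

lemma card_S_partitions_recurrence:
  assumes "\<forall>s\<in>S. s \<ge> 1"
  shows "card {P \<in> S_partitions S {..<n + 1}. Q (card P)} =
    (\<Sum>s\<in>{s\<in>S. s \<le> n + 1}. (n choose (s - 1)) *
      card {P \<in> S_partitions S {..<n + 1 - s}. Q (Suc (card P))})"
proof -
  define F where "F Q A = card {P \<in> S_partitions S A. Q (card P)}" for Q and A :: "nat set"
  have "F Q {..<n + 1} = (\<Sum>s\<in>{s\<in>S. s \<le> n + 1}.
      (n choose (s - 1)) * (1 * F (\<lambda>m. Q (Suc m)) {..<n + 1 - s}))"
    \<comment> \<open>A block of a partition carries no further structure, hence the constant weight
      1.\<close>
    by (rule marked_block_recurrence[OF _ assms, where w = "\<lambda>_. 1"])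
      (simp add: F_def card_S_partitions_marked)
  then show ?thesis by (simp add: F_def)
qed

theorem theorem5:
  fixes S :: "nat set" and n k :: nat
  assumes "S \<noteq> {}" and "\<forall>s\<in>S. s \<ge> 1" and "k \<ge> 1"
  shows
    "(real (S_perm_count S (n + 1)) =
        (\<Sum>s\<in>{s\<in>S. s \<le> n + 1}. fact n / fact (n + 1 - s) * real (S_perm_count S (n + 1 - s)))) \<and>
     (S_partition_count S (n + 1) =
        (\<Sum>s\<in>{s\<in>S. s \<le> n + 1}. (n choose (s - 1)) * S_partition_count S (n + 1 - s))) \<and>
     (real (S_stirling1 S (n + 1) k) =
        (\<Sum>s\<in>{s\<in>S. s \<le> n + 1}. fact n / fact (n + 1 - s) * real (S_stirling1 S (n + 1 - s) (k - 1)))) \<and>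
     (S_stirling2 S (n + 1) k =
        (\<Sum>s\<in>{s\<in>S. s \<le> n + 1}. (n choose (s - 1)) * S_stirling2 S (n + 1 - s) (k - 1)))"
proof -
  \<comment> \<open>By \<open>k \<ge> 1\<close> the subtraction is exact, so the shifted predicate
    for \<open>k\<close> blocks is the predicate for \<open>k - 1\<close> blocks. The constantly
    true predicate gives the two totals.\<close>
  have k: "Suc m = k \<longleftrightarrow> m = k - 1" for m using assms(3) by auto
  show ?thesis
    using card_S_perms_recurrence[OF assms(2), of n "\<lambda>_. True"]
      card_S_perms_recurrence[OF assms(2), of n "\<lambda>m. m = k"]
      card_S_partitions_recurrence[OF assms(2), of n "\<lambda>_. True"]
      card_S_partitions_recurrence[OF assms(2), of n "\<lambda>m. m = k"]
    unfolding S_perm_count_def S_partition_count_def S_stirling1_def S_stirling2_def k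
    by simp
qed

end
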